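(* Let $(Y,\tau)$ be a topological space and $(Z,\mathcal{U})$ a uniform space. Then the point-transitive-entourage topology on $EC(Y,Z)$ is splitting.
   Context: Uniform spaces $(Z,\mathcal{U})$ are given in the usual sense by a family $\mathcal{U}$ of entourages on a non-empty set $Z$. For $U\in\mathcal{U}$ and $z\in Z$, $U[z]=\{w\in Z : (z,w)\in U\}$. Equi-continuity: a function $f:(X,\tau)\to(Z,\mathcal{U})$ from a topological space to a uniform space is equi-continuous at $x\in X$ if for each $U\in\mathcal{U}$ there is an open neighbourhood $V$ of $x$ with $f(V)\subseteq U[f(x)]$; it is equi-continuous if this holds at all $x\in X$. $EC(Y,Z)$ is the set of all equi-continuous functions from $Y$ to $Z$. Point-transitive-entourage topology: an entourage $U_t\in\mathcal{U}$ is transitive if $U_t\circ U_t\subseteq U_t$. The point-transitive-entourage topology is the topology on $EC(Y,Z)$ generated by the subbasis consisting of the sets $(y,U_t)_z=\{f\in EC(Y,Z) : f(y)\in U_t[z]\}$, for $z\in Z$, $y\in Y$ and transitive entourages $U_t\in\mathcal{U}$. Associated maps: for a topological space $X$, maps $g:X\times Y\to Z$ and $g^*:X\to EC(Y,Z)$ are associated if $g^*(x)(y)=g(x,y)$ for all $x\in X$, $y\in Y$ (if $g$ is equi-continuous on the product space $X\times Y$, each $g(x,\cdot)$ lies in $EC(Y,Z)$). Splitting: a topology $\mathfrak{T}$ on $EC(Y,Z)$ is splitting if for each topological space $(X,\mu)$, equi-continuity of a map $g:X\times Y\to Z$ implies continuity of its associated map $g^*:X\to (EC(Y,Z),\mathfrak{T})$.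 *)

theory Defs
  imports "HOL-Analysis.Analysis"
begin

text \<open>
  The uniform space \<open>Z\<close> is a type of class \<open>uniform_space\<close>, whose uniformity is a filter on
  pairs; its entourages are the members of that filter. The spaces \<open>X\<close> and \<open>Y\<close> are
  abstract topologies with an explicit (possibly empty) carrier.
\<close>

definition entourages :: "('z::uniform_space \<times> 'z) set set" where
  "entourages = {U. eventually (\<lambda>p. p \<in> U) uniformity}"

definition transitive_entourages :: "('z::uniform_space \<times> 'z) set set" where
  "transitive_entourages = {U \<in> entourages. U O U \<subseteq> U}"

definition equicontinuous_at :: "'a topology \<Rightarrow> ('a \<Rightarrow> 'z::uniform_space) \<Rightarrow> 'a \<Rightarrow> bool" where
  "equicontinuous_at T f x \<longleftrightarrow>
     (\<forall>U \<in> entourages. \<exists>V. openin T V \<and> x \<in> V \<and> f ` V \<subseteq> U `` {f x})"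

definition equicontinuous :: "'a topology \<Rightarrow> ('a \<Rightarrow> 'z::uniform_space) \<Rightarrow> bool" where
  "equicontinuous T f \<longleftrightarrow> (\<forall>x \<in> topspace T. equicontinuous_at T f x)"

text \<open>
  Functions are taken extensional on the carrier of \<open>Y\<close>, so that elements of \<open>EC Y\<close> are
  equal iff they agree on that carrier.
\<close>

definition EC :: "'y topology \<Rightarrow> ('y \<Rightarrow> 'z::uniform_space) set" where
  "EC Y = {f \<in> extensional (topspace Y). equicontinuous Y f}"

definition point_entourage_set ::
    "'y topology \<Rightarrow> 'y \<Rightarrow> ('z::uniform_space \<times> 'z) set \<Rightarrow> 'z \<Rightarrow> ('y \<Rightarrow> 'z) set" where
  "point_entourage_set Y y U z = {f \<in> EC Y. f y \<in> U `` {z}}"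

definition point_transitive_entourage_subbasis ::
    "'y topology \<Rightarrow> ('y \<Rightarrow> 'z::uniform_space) set set" where
  "point_transitive_entourage_subbasis Y =
     {point_entourage_set Y y U z | y U z. y \<in> topspace Y \<and> U \<in> transitive_entourages}"

text \<open>
  Open sets are unions of finite intersections of subbasic sets, the empty intersection being
  \<open>EC Y\<close>. The constant \<open>topology_generated_by\<close> would instead give the empty carrier when
  the carrier of \<open>Y\<close>, and hence the subbasis, is empty.
\<close>

definition point_transitive_entourage_topology ::
    "'y topology \<Rightarrow> ('y \<Rightarrow> 'z::uniform_space) topology" where
  "point_transitive_entourage_topology Y =
     topology (arbitrary union_of
       (finite intersection_of (\<lambda>S. S \<in> point_transitive_entourage_subbasis Y) relative_to EC Y))"

definition associated_map :: "'y topology \<Rightarrow> ('x \<times> 'y \<Rightarrow> 'z) \<Rightarrow> 'x \<Rightarrow> 'y \<Rightarrow> 'z" where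
  "associated_map Y g x = (\<lambda>y \<in> topspace Y. g (x, y))"

text \<open>
  HOL cannot quantify over types inside a formula, so the type of points of the test spaces
  \<open>X\<close> is a parameter; a theorem with this type left free holds for every test space.
\<close>

definition splitting ::
    "'x itself \<Rightarrow> 'y topology \<Rightarrow> ('y \<Rightarrow> 'z::uniform_space) topology \<Rightarrow> bool" where
  "splitting _ Y T \<longleftrightarrow> topspace T = EC Y \<and>
     (\<forall>(X :: 'x topology) g. equicontinuous (prod_topology X Y) g \<longrightarrow>
        continuous_map X T (associated_map Y g))"

end

theory Submission
  imports Defs
begin

text \<open>
  Equi-continuity of a single function is continuity for the topology induced by the
  uniformity, and for that topology the sections \<open>U[z]\<close> of a transitive entourage are open:
  \<open>U[w] \<subseteq> U[z]\<close> whenever \<open>w \<in> U[z]\<close>. Hence the point-transitive-entourage topology is coarser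
  than the topology of pointwise convergence, and \<open>x \<mapsto> g (x, \<sqdot>)\<close> is pointwise
  continuous because \<open>g\<close> is separately continuous.
\<close>

lemma eventually_nhds_iff_entourage:
  "eventually P (nhds z) \<longleftrightarrow> (\<exists>U \<in> entourages. \<forall>w \<in> U `` {z}. P w)"
proof
  assume "eventually P (nhds z)"
  then have "{(x, w). x = z \<longrightarrow> P w} \<in> entourages"
    by (simp add: entourages_def eventually_nhds_uniformity case_prod_unfold)
  then show "\<exists>U \<in> entourages. \<forall>w \<in> U `` {z}. P w"
    by (rule rev_bexI) simp
next
  assume "\<exists>U \<in> entourages. \<forall>w \<in> U `` {z}. P w"
  then obtain U where U: "\<forall>\<^sub>F p in uniformity. p \<in> U" and P: "\<And>w. (z, w) \<in> U \<Longrightarrow> P w"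
    by (auto simp: entourages_def)
  from U have "\<forall>\<^sub>F (x, w) in uniformity. x = z \<longrightarrow> P w"
    by (rule eventually_mono) (auto intro: P)
  then show "eventually P (nhds z)"
    by (simp add: eventually_nhds_uniformity)
qed

lemma equicontinuous_at_iff_topcontinuous_at:
  fixes f :: "'a \<Rightarrow> 'z::uniform_space"
  assumes "x \<in> topspace T"
  shows "equicontinuous_at T f x \<longleftrightarrow> topcontinuous_at T euclidean f x"
proof
  assume f: "equicontinuous_at T f x"
  have "\<exists>V. openin T V \<and> x \<in> V \<and> (\<forall>v \<in> V. f v \<in> N)" if "open N" "f x \<in> N" for N
  proof -
    have "\<forall>\<^sub>F w in nhds (f x). w \<in> N"
      using that by (rule eventually_nhds_in_open)
    then obtain U where "U \<in> entourages" and U: "U `` {f x} \<subseteq> N"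
      unfolding eventually_nhds_iff_entourage by blast
    with f obtain V where "openin T V" "x \<in> V" "f ` V \<subseteq> U `` {f x}"
      unfolding equicontinuous_at_def by blast
    with U show ?thesis
      by blast
  qed
  with assms show "topcontinuous_at T euclidean f x"
    by (simp add: topcontinuous_at_def)
next
  assume f: "topcontinuous_at T euclidean f x"
  show "equicontinuous_at T f x"
    unfolding equicontinuous_at_def
  proof
    fix U :: "('z \<times> 'z) set" assume "U \<in> entourages"
    then have "\<forall>\<^sub>F w in nhds (f x). w \<in> U `` {f x}"
      unfolding eventually_nhds_iff_entourage by blast
    then obtain N where "open N" "f x \<in> N" and N: "N \<subseteq> U `` {f x}"
      unfolding eventually_nhds by blast
    with f obtain V where "openin T V" "x \<in> V" "\<forall>v \<in> V. f v \<in> N"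
      by (auto simp: topcontinuous_at_def)
    with N show "\<exists>V. openin T V \<and> x \<in> V \<and> f ` V \<subseteq> U `` {f x}"
      by blast
  qed
qed

lemma equicontinuous_iff_continuous_map:
  "equicontinuous T f \<longleftrightarrow> continuous_map T euclidean f"
  by (simp add: equicontinuous_def equicontinuous_at_iff_topcontinuous_at
      continuous_map_eq_topcontinuous_at)

lemma open_transitive_entourage_Image:
  assumes "U \<in> transitive_entourages"
  shows "open (U `` A)"
proof (rule topological_space_class.openI)
  fix w assume w: "w \<in> U `` A"
  have U: "U \<in> entourages" and trans: "U O U \<subseteq> U"
    using assms by (auto simp: transitive_entourages_def)
  from w trans have "U `` {w} \<subseteq> U `` A"
    by blast
  with U have "\<forall>\<^sub>F v in nhds w. v \<in> U `` A"
    unfolding eventually_nhds_iff_entourage by blast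
  then show "\<exists>N. open N \<and> w \<in> N \<and> N \<subseteq> U `` A"
    unfolding eventually_nhds by blast
qed

lemma continuous_map_into_point_transitive_entourage_topology:
  fixes F :: "'x \<Rightarrow> 'y \<Rightarrow> 'z::uniform_space"
  assumes F_in_EC: "F \<in> topspace X \<rightarrow> EC Y"
    and cont: "\<And>y. y \<in> topspace Y \<Longrightarrow> continuous_map X euclidean (\<lambda>x. F x y)"
  shows "continuous_map X (point_transitive_entourage_topology Y) F"
  unfolding point_transitive_entourage_topology_def
proof (rule continuous_map_into_topology_subbase)
  fix S :: "('y \<Rightarrow> 'z) set" assume "S \<in> point_transitive_entourage_subbasis Y"
  then obtain y U z where S: "S = point_entourage_set Y y U z"
    and y: "y \<in> topspace Y" and U: "U \<in> transitive_entourages"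
    by (auto simp: point_transitive_entourage_subbasis_def)
  have "openin euclidean (U `` {z})"
    using open_transitive_entourage_Image[OF U] by simp
  with cont[OF y] have "openin X {x \<in> topspace X. F x y \<in> U `` {z}}"
    by (rule openin_continuous_map_preimage)
  also have "{x \<in> topspace X. F x y \<in> U `` {z}} = {x \<in> topspace X. F x \<in> S}"
    using F_in_EC by (auto simp: S point_entourage_set_def)
  finally show "openin X {x \<in> topspace X. F x \<in> S}" .
qed (use F_in_EC in auto)

lemma associated_map_in_EC:
  assumes "equicontinuous (prod_topology X Y) g" and "x \<in> topspace X"
  shows "associated_map Y g x \<in> EC Y"
proof -
  have "continuous_map Y euclidean (g \<circ> Pair x)"
    using assms by (simp add: equicontinuous_iff_continuous_map continuous_map_o_Pair)
  then have "continuous_map Y euclidean (associated_map Y g x)"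
    by (rule continuous_map_eq) (simp add: associated_map_def)
  then show ?thesis
    by (simp add: EC_def equicontinuous_iff_continuous_map associated_map_def)
qed

lemma continuous_map_associated_map_apply:
  assumes "equicontinuous (prod_topology X Y) g" and "y \<in> topspace Y"
  shows "continuous_map X euclidean (\<lambda>x. associated_map Y g x y)"
proof -
  have "continuous_map X (prod_topology X Y) (\<lambda>x. (x, y))"
    using assms(2) by (simp add: continuous_map_paired)
  then have "continuous_map X euclidean (g \<circ> (\<lambda>x. (x, y)))"
    using assms(1) unfolding equicontinuous_iff_continuous_map
    by (rule continuous_map_compose)
  then show ?thesis
    using assms(2) by (simp add: associated_map_def o_def)
qed

theorem theorem4p11:
  fixes Y :: "'y topology"
  shows "splitting TYPE('x) Y
    (point_transitive_entourage_topology Y :: ('y \<Rightarrow> 'z::uniform_space) topology)"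
  unfolding splitting_def
proof (intro conjI allI impI)
  show "topspace (point_transitive_entourage_topology Y) = (EC Y :: ('y \<Rightarrow> 'z) set)"
    by (simp add: point_transitive_entourage_topology_def)
next
  fix X :: "'x topology" and g :: "'x \<times> 'y \<Rightarrow> 'z"
  assume g: "equicontinuous (prod_topology X Y) g"
  show "continuous_map X (point_transitive_entourage_topology Y) (associated_map Y g)"
  proof (rule continuous_map_into_point_transitive_entourage_topology)
    show "associated_map Y g \<in> topspace X \<rightarrow> EC Y"
      using g by (simp add: associated_map_in_EC)
    show "continuous_map X euclidean (\<lambda>x. associated_map Y g x y)" if "y \<in> topspace Y" for y
      using g that by (rule continuous_map_associated_map_apply)
  qed
qed

end
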